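(* Let $\mathbf M\in\mathbb R^{d\times d}$ be symmetric positive semidefinite and $\Delta,\Gamma\in[0,1]$. If $u\in\mathbb R^d$ is a $(\Delta,\Gamma)$-$1$-cPCA of $\mathbf M$, then $u$ is a $(\Gamma+\Delta)$-$1$-ePCA of $\mathbf M$.
   Context: $\lambda_1(\mathbf M)$ is the largest eigenvalue of $\mathbf M$; $\mathbf V^{<\lambda}(\mathbf M)$ is an orthonormal matrix whose columns span the eigenspace of $\mathbf M$ for eigenvalues $<\lambda$. $(\Delta,\Gamma)$-$1$-cPCA of $\mathbf M$: a unit vector $u$ with $\|(\mathbf V^{<(1-\Gamma)\lambda_1(\mathbf M)}(\mathbf M))^\top u\|_2^2\le\Delta$. $\epsilon$-$1$-ePCA of $\mathbf M$: a unit vector $u$ with $u^\top\mathbf Mu\ge(1-\epsilon)\lambda_1(\mathbf M)$ (trivially true if $\epsilon\ge1$). *)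

theory Defs
  imports "HOL-Analysis.Analysis"
begin

definition psd_matrix :: "real^'n^'n \<Rightarrow> bool" where
  "psd_matrix M \<longleftrightarrow> transpose M = M \<and> (\<forall>x. 0 \<le> x \<bullet> (M *v x))"

definition eigenvector :: "real^'n^'n \<Rightarrow> real^'n \<Rightarrow> real \<Rightarrow> bool" where
  "eigenvector M v \<mu> \<longleftrightarrow> v \<noteq> 0 \<and> M *v v = \<mu> *\<^sub>R v"

definition eigenvalue :: "real^'n^'n \<Rightarrow> real \<Rightarrow> bool" where
  "eigenvalue M \<mu> \<longleftrightarrow> (\<exists>v. eigenvector M v \<mu>)"

text \<open>Only used for symmetric matrices, whose set of real eigenvalues is finite and nonempty.\<close>

definition lambda1 :: "real^'n^'n \<Rightarrow> real" where
  "lambda1 M = Max {\<mu>. eigenvalue M \<mu>}"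

definition eigenspace_below :: "real^'n^'n \<Rightarrow> real \<Rightarrow> (real^'n) set" where
  "eigenspace_below M t = span {v. \<exists>\<mu><t. eigenvector M v \<mu>}"

text \<open>The number of columns of \<open>V\<close> depends on \<open>M\<close> and \<open>t\<close> and may be zero, so \<open>V\<close> is
  given as the list of its columns. The first conjunct says that \<open>V\<^sup>T V\<close> is the identity matrix.\<close>

definition eigenbasis_below :: "real^'n^'n \<Rightarrow> real \<Rightarrow> (real^'n) list \<Rightarrow> bool" where
  "eigenbasis_below M t V \<longleftrightarrow>
     (\<forall>i<length V. \<forall>j<length V. V ! i \<bullet> V ! j = (if i = j then 1 else 0)) \<and>
     span (set V) = eigenspace_below M t"

text \<open>The squared Euclidean norm of \<open>V\<^sup>T u\<close>, whose entries are the inner products of the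
  columns of \<open>V\<close> with \<open>u\<close>.\<close>

definition norm_sq_transpose_mult :: "(real^'n) list \<Rightarrow> real^'n \<Rightarrow> real" where
  "norm_sq_transpose_mult V u = (\<Sum>i<length V. (V ! i \<bullet> u)\<^sup>2)"

lemma eigenbasis_below_set:
  assumes "eigenbasis_below M t V"
  shows "distinct V" "pairwise orthogonal (set V)" "\<forall>v\<in>set V. norm v = 1"
    "norm_sq_transpose_mult V u = (\<Sum>v\<in>set V. (v \<bullet> u)\<^sup>2)"
proof -
  have o: "V ! i \<bullet> V ! j = (if i = j then 1 else 0)" if "i < length V" "j < length V" for i j
    using assms that unfolding eigenbasis_below_def by blast
  show d: "distinct V"
    unfolding distinct_conv_nth using o by (metis zero_neq_one)
  show "pairwise orthogonal (set V)"
    using o by (auto simp: pairwise_def orthogonal_def in_set_conv_nth split: if_splits)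
  show "\<forall>v\<in>set V. norm v = 1"
    using o by (auto simp: norm_eq_1 in_set_conv_nth)
  have "(\<Sum>v\<in>set V. (v \<bullet> u)\<^sup>2) = sum_list (map (\<lambda>v. (v \<bullet> u)\<^sup>2) V)"
    using d by (simp add: sum_list_distinct_conv_sum_set)
  then show "norm_sq_transpose_mult V u = (\<Sum>v\<in>set V. (v \<bullet> u)\<^sup>2)"
    by (simp add: norm_sq_transpose_mult_def sum_list_sum_nth atLeast0LessThan)
qed

lemma eigenbasis_below_exists: "\<exists>V. eigenbasis_below M t V"
proof -
  obtain B where B: "pairwise orthogonal B" "\<And>x. x \<in> B \<Longrightarrow> norm x = 1"
    "independent B" "span B = eigenspace_below M t"
    by (metis orthonormal_basis_subspace subspace_span eigenspace_below_def)
  then obtain V where V: "set V = B" "distinct V"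
    using finite_distinct_list independent_imp_finite by metis
  have "V ! i \<bullet> V ! j = (if i = j then 1 else 0)" if "i < length V" "j < length V" for i j
  proof (cases "i = j")
    case True
    then show ?thesis using B(2) V that by (metis norm_eq_1 nth_mem)
  next
    case False
    then have "V ! i \<noteq> V ! j" using V that nth_eq_iff_index_eq by blast
    then show ?thesis using B(1) V that False by (auto simp: pairwise_def orthogonal_def)
  qed
  then show ?thesis using B V unfolding eigenbasis_below_def by blast
qed

lemma norm_sq_transpose_mult_unique:
  assumes V: "eigenbasis_below M t V" and W: "eigenbasis_below M t W"
  shows "norm_sq_transpose_mult V u = norm_sq_transpose_mult W u"
proof -
  have sp: "span (set V) = span (set W)"
    using V W by (simp add: eigenbasis_below_def)
  define p where "p = (\<Sum>v\<in>set V. (v \<bullet> u) *\<^sub>R v)"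
  have pW: "p \<in> span (set W)"
    unfolding p_def sp[symmetric] by (intro span_sum span_scale span_base)
  have p: "(\<Sum>w\<in>set W. (p \<bullet> w) *\<^sub>R w) = p"
    using orthonormal_basis_expand[of "set W" p] eigenbasis_below_set[OF W] pW by simp
  have pw: "p \<bullet> w = w \<bullet> u" if "w \<in> set W" for w
  proof -
    have "w \<in> span (set V)" using that sp span_base by blast
    then have e: "(\<Sum>v\<in>set V. (w \<bullet> v) *\<^sub>R v) = w"
      using orthonormal_basis_expand[of "set V" w] eigenbasis_below_set[OF V] by simp
    have "p \<bullet> w = (\<Sum>v\<in>set V. (w \<bullet> v) *\<^sub>R v) \<bullet> u"
      unfolding p_def inner_sum_left inner_scaleR_left
      by (intro sum.cong refl) (simp add: inner_commute mult.commute)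
    then show ?thesis using e by simp
  qed
  have "norm_sq_transpose_mult V u = p \<bullet> u"
    using eigenbasis_below_set(4)[OF V] by (simp add: p_def inner_sum_left power2_eq_square)
  also have "\<dots> = (\<Sum>w\<in>set W. (p \<bullet> w) *\<^sub>R w) \<bullet> u" by (simp add: p)
  also have "\<dots> = norm_sq_transpose_mult W u"
    using eigenbasis_below_set(4)[OF W] by (simp add: inner_sum_left power2_eq_square pw)
  finally show ?thesis .
qed

text \<open>By the two preceding lemmas the choice of \<open>V\<close> is immaterial.\<close>

definition is_cPCA :: "real \<Rightarrow> real \<Rightarrow> real^'n^'n \<Rightarrow> real^'n \<Rightarrow> bool" where
  "is_cPCA \<Delta> \<Gamma> M u \<longleftrightarrow> norm u = 1 \<and>
     (\<exists>V. eigenbasis_below M ((1 - \<Gamma>) * lambda1 M) V \<and> norm_sq_transpose_mult V u \<le> \<Delta>)"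

definition is_ePCA :: "real \<Rightarrow> real^'n^'n \<Rightarrow> real^'n \<Rightarrow> bool" where
  "is_ePCA \<epsilon> M u \<longleftrightarrow> norm u = 1 \<and> u \<bullet> (M *v u) \<ge> (1 - \<epsilon>) * lambda1 M"

end

theory Submission
  imports Defs
begin

text \<open>
  Write \<open>t = (1 - \<Gamma>) \<lambda>\<^sub>1\<close> and let \<open>E\<close> be the span of the eigenvectors of \<open>M\<close> with eigenvalue
  below \<open>t\<close>. Split \<open>u = p + q\<close> with \<open>p \<in> E\<close> and \<open>q \<bottom> E\<close>. The orthogonal complement of \<open>E\<close> is
  invariant under \<open>M\<close>, so the mixed terms of the quadratic form vanish and
  \<open>u \<bullet> M u = p \<bullet> M p + q \<bullet> M q\<close>. The first summand is nonnegative. The second is at least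
  \<open>t |q|\<^sup>2 = t (1 - |p|\<^sup>2)\<close>, and the cPCA condition says \<open>|p|\<^sup>2 \<le> \<Delta>\<close>. Hence
  \<open>u \<bullet> M u \<ge> (1 - \<Gamma>) (1 - \<Delta>) \<lambda>\<^sub>1 \<ge> (1 - \<Gamma> - \<Delta>) \<lambda>\<^sub>1\<close>, the last step because \<open>\<lambda>\<^sub>1 \<ge> 0\<close>.

  The estimate \<open>q \<bullet> M q \<ge> t |q|\<^sup>2\<close> comes from a variational argument instead of a full
  diagonalization: on an invariant subspace the Rayleigh quotient attains its minimum at an
  eigenvector (\<open>rayleigh_minimum_is_eigenvalue\<close>). On the complement of \<open>E\<close> the minimum cannot be
  below \<open>t\<close>, since the minimizer would then lie in \<open>E\<close> and be orthogonal to itself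
  (\<open>quadratic_form_ge_off_eigenspace_below\<close>). The same variational lemma, on the whole space, gives
  that eigenvalues exist; as there are finitely many of them, \<open>\<lambda>\<^sub>1\<close> is itself an eigenvalue.
\<close>

lemma symmetric_matrix_inner:
  fixes M :: "real^'n^'n"
  assumes "transpose M = M"
  shows "x \<bullet> (M *v y) = (M *v x) \<bullet> y"
  using dot_lmul_matrix[of x M y] transpose_matrix_vector[of M x] assms by simp

text \<open>The minimum over the unit sphere of \<open>W\<close> exists by compactness. For the residual
  \<open>r = M v - \<mu> v\<close> at a minimizer \<open>v\<close>, a small step from \<open>v\<close> in direction \<open>-r\<close> would decrease
  \<open>x \<bullet> M x - \<mu> |x|\<^sup>2\<close> below its minimum \<open>0\<close> unless \<open>r = 0\<close>; invariance of \<open>W\<close> is what keeps the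
  step inside \<open>W\<close>.\<close>

lemma rayleigh_minimum_is_eigenvalue:
  fixes M :: "real^'n^'n"
  assumes sym: "transpose M = M"
    and W: "subspace W" "W \<noteq> {0}"
    and inv: "\<And>x. x \<in> W \<Longrightarrow> M *v x \<in> W"
  obtains v \<mu> where "v \<in> W" "eigenvector M v \<mu>" "\<And>x. x \<in> W \<Longrightarrow> \<mu> * (x \<bullet> x) \<le> x \<bullet> (M *v x)"
proof -
  let ?S = "sphere 0 1 \<inter> W"
  have "compact ?S"
    by (simp add: W(1) closed_subspace compact_Int_closed)
  moreover have normalized: "(1 / norm x) *\<^sub>R x \<in> ?S" if "x \<in> W" "x \<noteq> 0" for x
    using that W(1) by (simp add: subspace_scale)
  moreover obtain x0 where "x0 \<in> W" "x0 \<noteq> 0"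
    using W subspace_0 by blast
  moreover have "continuous_on ?S (\<lambda>x. x \<bullet> (M *v x))"
    by (intro continuous_intros linear_continuous_on linear_linear[THEN iffD2] matrix_vector_mul_linear)
  ultimately obtain v where v: "v \<in> ?S" and
    min: "\<And>x. x \<in> ?S \<Longrightarrow> v \<bullet> (M *v v) \<le> x \<bullet> (M *v x)"
    using continuous_attains_inf[of ?S "\<lambda>x. x \<bullet> (M *v x)"] by blast
  define \<mu> where "\<mu> = v \<bullet> (M *v v)"
  have vv: "v \<bullet> v = 1" and vW: "v \<in> W"
    using v by (auto simp: norm_eq_1)
  have bound: "\<mu> * (x \<bullet> x) \<le> x \<bullet> (M *v x)" if "x \<in> W" for x
  proof (cases "x = 0")
    case False
    have "\<mu> \<le> ((1 / norm x) *\<^sub>R x) \<bullet> (M *v ((1 / norm x) *\<^sub>R x))"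
      using min[OF normalized[OF that False]] by (simp add: \<mu>_def)
    also have "\<dots> = (x \<bullet> (M *v x)) / (x \<bullet> x)"
      by (simp add: matrix_vector_mult_scaleR dot_square_norm power2_eq_square)
    finally show ?thesis
      using False by (simp add: field_simps)
  qed simp
  define r where "r = M *v v - \<mu> *\<^sub>R v"
  have rW: "r \<in> W"
    unfolding r_def by (intro subspace_diff subspace_scale W inv vW)
  have "r = 0"
  proof (rule ccontr)
    assume "r \<noteq> 0"
    define a where "a = r \<bullet> r"
    define c where "c = r \<bullet> (M *v r) - \<mu> * a"
    have a: "a > 0" using \<open>r \<noteq> 0\<close> by (simp add: a_def)
    have c: "c \<ge> 0" using bound[OF rW] by (simp add: c_def a_def)
    have "r \<bullet> (M *v v) - \<mu> * (r \<bullet> v) = r \<bullet> (M *v v - \<mu> *\<^sub>R v)"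
      by (simp add: inner_diff_right)
    then have rr: "r \<bullet> (M *v v) - \<mu> * (v \<bullet> r) = a"
      by (simp add: a_def r_def[symmetric] inner_commute)
    moreover have "v \<bullet> (M *v r) = r \<bullet> (M *v v)"
      using symmetric_matrix_inner[OF sym, of v r] by (simp add: inner_commute)
    ultimately have rr': "v \<bullet> (M *v r) - \<mu> * (v \<bullet> r) = a"
      by simp
    have expand: "0 \<le> c * s^2 - 2 * s * a" for s
    proof -
      have "v - s *\<^sub>R r \<in> W"
        by (intro subspace_diff subspace_scale W vW rW)
      from bound[OF this] have "0 \<le> (v - s *\<^sub>R r) \<bullet> (M *v (v - s *\<^sub>R r))
          - \<mu> * ((v - s *\<^sub>R r) \<bullet> (v - s *\<^sub>R r))"
        by simp
      also have "\<dots> = (v \<bullet> (M *v v) - \<mu> * (v \<bullet> v)) - s * (v \<bullet> (M *v r) - \<mu> * (v \<bullet> r))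
          - s * (r \<bullet> (M *v v) - \<mu> * (v \<bullet> r)) + s^2 * c"
        by (simp add: matrix_vector_mult_diff_distrib matrix_vector_mult_scaleR inner_diff
            inner_commute[of r v] c_def a_def power2_eq_square algebra_simps)
      also have "\<dots> = c * s^2 - 2 * s * a"
        unfolding rr rr' using vv by (simp add: \<mu>_def)
      finally show ?thesis .
    qed
    \<comment> \<open>Any \<open>s\<close> with \<open>0 < s\<close> and \<open>c s < 2 a\<close> gives a contradiction.\<close>
    define s where "s = a / (c + 1)"
    have s: "s > 0" "c * s \<le> a"
      using a c by (simp_all add: s_def field_simps)
    have "c * s^2 = s * (c * s)" by (simp add: power2_eq_square)
    also have "\<dots> \<le> s * a" using s by (intro mult_left_mono) auto
    also have "\<dots> < 2 * s * a" using s a by simp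
    finally show False using expand[of s] by simp
  qed
  then have "eigenvector M v \<mu>"
    using vv by (auto simp: eigenvector_def r_def)
  with vW bound that show thesis by blast
qed

lemma eigenvectors_orthogonal:
  fixes M :: "real^'n^'n"
  assumes "transpose M = M" "eigenvector M v \<mu>" "eigenvector M w \<nu>" "\<mu> \<noteq> \<nu>"
  shows "v \<bullet> w = 0"
  using symmetric_matrix_inner[OF assms(1), of v w] assms(2-4) by (auto simp: eigenvector_def)

text \<open>Choosing one eigenvector per eigenvalue gives an orthogonal family of nonzero vectors, which
  is independent and thus finite.\<close>

lemma finite_eigenvalues:
  fixes M :: "real^'n^'n"
  assumes sym: "transpose M = M"
  shows "finite {\<mu>. eigenvalue M \<mu>}"
proof -
  define f where "f \<mu> = (SOME v. eigenvector M v \<mu>)" for \<mu>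
  have f: "eigenvector M (f \<mu>) \<mu>" if "eigenvalue M \<mu>" for \<mu>
    using that unfolding eigenvalue_def f_def by (rule someI_ex)
  have orth: "f \<mu> \<bullet> f \<nu> = 0" if "eigenvalue M \<mu>" "eigenvalue M \<nu>" "\<mu> \<noteq> \<nu>" for \<mu> \<nu>
    using eigenvectors_orthogonal[OF sym f f] that by blast
  have nz: "f \<mu> \<noteq> 0" if "eigenvalue M \<mu>" for \<mu>
    using f[OF that] by (simp add: eigenvector_def)
  have "pairwise orthogonal (f ` {\<mu>. eigenvalue M \<mu>})"
    using orth by (auto simp: pairwise_def orthogonal_def)
  then have "finite (f ` {\<mu>. eigenvalue M \<mu>})"
    using pairwise_orthogonal_imp_finite by blast
  moreover have "inj_on f {\<mu>. eigenvalue M \<mu>}"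
    using orth nz by (intro inj_onI) (metis inner_eq_zero_iff mem_Collect_eq)
  ultimately show ?thesis
    using finite_imageD by blast
qed

lemma eigenvalue_lambda1:
  fixes M :: "real^'n^'n"
  assumes sym: "transpose M = M"
  shows "eigenvalue M (lambda1 M)"
proof -
  have "(UNIV :: (real^'n) set) \<noteq> {0}"
    using UNIV_not_singleton by blast
  then obtain v \<mu> where "eigenvector M v \<mu>"
    using rayleigh_minimum_is_eigenvalue[OF sym subspace_UNIV] by blast
  then have "{\<mu>. eigenvalue M \<mu>} \<noteq> {}"
    by (auto simp: eigenvalue_def)
  then show ?thesis
    using Max_in[OF finite_eigenvalues[OF sym]] by (simp add: lambda1_def)
qed

lemma psd_eigenvalue_nonneg:
  assumes "psd_matrix M" "eigenvalue M \<mu>"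
  shows "0 \<le> \<mu>"
proof -
  obtain v where v: "v \<noteq> 0" "M *v v = \<mu> *\<^sub>R v"
    using assms(2) by (auto simp: eigenvalue_def eigenvector_def)
  have "0 \<le> \<mu> * (v \<bullet> v)"
    using assms(1) v(2) by (metis psd_matrix_def inner_scaleR_right)
  then show ?thesis
    using v(1) by (metis inner_gt_zero_iff mult_neg_pos not_less)
qed

text \<open>By symmetry, \<open>v \<bullet> M x = \<mu> (v \<bullet> x)\<close> for each eigenvector \<open>v\<close> spanning the eigenspace.\<close>

lemma orthogonal_to_eigenspace_below_invariant:
  fixes M :: "real^'n^'n"
  assumes sym: "transpose M = M"
    and x: "\<And>y. y \<in> eigenspace_below M t \<Longrightarrow> orthogonal x y"
    and y: "y \<in> eigenspace_below M t"
  shows "orthogonal (M *v x) y"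
proof -
  have "orthogonal (M *v x) v" if "eigenvector M v \<mu>" "\<mu> < t" for v \<mu>
  proof -
    have "orthogonal x v"
      using that by (intro x) (auto simp: eigenspace_below_def intro!: span_base)
    then show ?thesis
      using that by (simp add: orthogonal_def eigenvector_def flip: symmetric_matrix_inner[OF sym])
  qed
  then show ?thesis
    using orthogonal_to_span[OF y[unfolded eigenspace_below_def], of "M *v x"] by blast
qed

lemma quadratic_form_ge_off_eigenspace_below:
  fixes M :: "real^'n^'n"
  assumes sym: "transpose M = M"
    and q: "\<And>y. y \<in> eigenspace_below M t \<Longrightarrow> orthogonal q y"
  shows "t * (q \<bullet> q) \<le> q \<bullet> (M *v q)"
proof (cases "q = 0")
  case False
  define W where "W = {x. \<forall>y\<in>eigenspace_below M t. orthogonal x y}"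
  have "subspace W"
    unfolding W_def by (auto simp: subspace_def orthogonal_def inner_add_left)
  moreover have qW: "q \<in> W" "W \<noteq> {0}"
    using q False by (auto simp: W_def)
  moreover have "M *v x \<in> W" if "x \<in> W" for x
    using that orthogonal_to_eigenspace_below_invariant[OF sym] unfolding W_def by blast
  ultimately obtain v \<mu> where v: "v \<in> W" "eigenvector M v \<mu>"
    and bound: "\<And>x. x \<in> W \<Longrightarrow> \<mu> * (x \<bullet> x) \<le> x \<bullet> (M *v x)"
    using rayleigh_minimum_is_eigenvalue[OF sym] by metis
  have "t \<le> \<mu>"
  proof (rule ccontr)
    assume "\<not> t \<le> \<mu>"
    then have "\<mu> < t" by simp
    then have "v \<in> eigenspace_below M t"
      using v(2) by (auto simp: eigenspace_below_def intro!: span_base)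
    then have "orthogonal v v"
      using v(1) by (simp add: W_def)
    then show False
      using v(2) by (simp add: eigenvector_def orthogonal_def)
  qed
  then have "t * (q \<bullet> q) \<le> \<mu> * (q \<bullet> q)"
    by (intro mult_right_mono) auto
  with bound[OF qW(1)] show ?thesis by simp
qed simp

text \<open>The matrix \<open>V V\<^sup>T\<close> is the orthogonal projection onto the eigenspace; \<open>p = V V\<^sup>T u\<close>.\<close>

lemma eigenbasis_below_decomposition:
  assumes V: "eigenbasis_below M t V"
  obtains p q where "u = p + q" "p \<in> eigenspace_below M t"
    "\<And>y. y \<in> eigenspace_below M t \<Longrightarrow> orthogonal q y"
    "p \<bullet> p = norm_sq_transpose_mult V u"
proof -
  note V_set = eigenbasis_below_set[OF V]
  have E: "span (set V) = eigenspace_below M t"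
    using V by (simp add: eigenbasis_below_def)
  define p where "p = (\<Sum>v\<in>set V. (v \<bullet> u) *\<^sub>R v)"
  have pE: "p \<in> eigenspace_below M t"
    unfolding p_def E[symmetric] by (intro span_sum span_scale span_base)
  have pv: "p \<bullet> w = w \<bullet> u" if w: "w \<in> set V" for w
  proof -
    have "p \<bullet> w = (\<Sum>v\<in>set V. (v \<bullet> u) * (v \<bullet> w))"
      by (simp add: p_def inner_sum_left)
    also have "\<dots> = (\<Sum>v\<in>set V. if v = w then w \<bullet> u else 0)"
      using V_set(2,3) w by (intro sum.cong) (auto simp: pairwise_def orthogonal_def norm_eq_1)
    finally show ?thesis using w by simp
  qed
  have "orthogonal (u - p) y" if "y \<in> eigenspace_below M t" for y
  proof (rule orthogonal_to_span)
    show "y \<in> span (set V)" using that by (simp add: E)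
    show "orthogonal (u - p) w" if "w \<in> set V" for w
      using pv[OF that] by (simp add: orthogonal_def inner_diff_left inner_commute[of u w])
  qed
  moreover have "p \<bullet> p = norm_sq_transpose_mult V u"
  proof -
    have "p \<bullet> p = (\<Sum>v\<in>set V. (v \<bullet> u) * (p \<bullet> v))"
      by (subst (2) p_def) (simp add: inner_sum_right)
    also have "\<dots> = norm_sq_transpose_mult V u"
      unfolding V_set(4) by (intro sum.cong) (simp_all add: pv power2_eq_square)
    finally show ?thesis .
  qed
  ultimately show thesis
    using that[of p "u - p"] pE by simp
qed

theorem lemma2:
  fixes M :: "real^'d^'d" and u :: "real^'d" and \<Delta> \<Gamma> :: real
  assumes "psd_matrix M"
    and "\<Delta> \<in> {0..1}" and "\<Gamma> \<in> {0..1}"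
    and "is_cPCA \<Delta> \<Gamma> M u"
  shows "is_ePCA (\<Gamma> + \<Delta>) M u"
proof -
  define l where "l = lambda1 M"
  define t where "t = (1 - \<Gamma>) * l"
  have sym: "transpose M = M" and psd: "\<And>x. 0 \<le> x \<bullet> (M *v x)"
    using assms(1) by (auto simp: psd_matrix_def)
  have l: "0 \<le> l"
    unfolding l_def using psd_eigenvalue_nonneg[OF assms(1) eigenvalue_lambda1[OF sym]] .
  have t: "0 \<le> t"
    using l assms(3) by (simp add: t_def)
  obtain V where u: "norm u = 1" and V: "eigenbasis_below M t V"
    and V_le: "norm_sq_transpose_mult V u \<le> \<Delta>"
    using assms(4) by (auto simp: is_cPCA_def t_def l_def)
  obtain p q where pq: "u = p + q" and p: "p \<in> eigenspace_below M t"
    and q: "\<And>y. y \<in> eigenspace_below M t \<Longrightarrow> orthogonal q y"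
    and pp: "p \<bullet> p = norm_sq_transpose_mult V u"
    using eigenbasis_below_decomposition[OF V] by metis
  have "orthogonal q p" "orthogonal (M *v q) p"
    using q[OF p] orthogonal_to_eigenspace_below_invariant[OF sym q p] by auto
  then have mixed: "p \<bullet> q = 0" "p \<bullet> (M *v q) = 0" "q \<bullet> (M *v p) = 0"
    using symmetric_matrix_inner[OF sym, of q p] by (simp_all add: orthogonal_def inner_commute)
  have "u \<bullet> u = p \<bullet> p + q \<bullet> q"
    using mixed(1) by (simp add: pq inner_add inner_commute)
  then have "1 - \<Delta> \<le> q \<bullet> q"
    using u V_le pp by (simp add: norm_eq_1)
  have "(1 - (\<Gamma> + \<Delta>)) * l = t * (1 - \<Delta>) - \<Gamma> * \<Delta> * l"
    by (simp add: t_def algebra_simps)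
  also have "\<dots> \<le> t * (1 - \<Delta>)"
    using l assms(2,3) by simp
  also have "\<dots> \<le> t * (q \<bullet> q)"
    using \<open>1 - \<Delta> \<le> q \<bullet> q\<close> t by (rule mult_left_mono)
  also have "\<dots> \<le> q \<bullet> (M *v q)"
    by (rule quadratic_form_ge_off_eigenspace_below[OF sym q])
  also have "\<dots> \<le> p \<bullet> (M *v p) + q \<bullet> (M *v q)"
    using psd[of p] by simp
  also have "\<dots> = u \<bullet> (M *v u)"
    using mixed by (simp add: pq matrix_vector_right_distrib inner_add)
  finally show ?thesis
    using u by (simp add: is_ePCA_def l_def)
qed

end
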